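(* Let $\|\cdot\|$ be a norm on $\mathbb R^n$ and let $R$ be a finite subset of the normed space $(\mathbb R^n,\|\cdot\|)$. Then the minimized expansion constant of $R$ satisfies $c_m(R)\le 2^n$.
   Context: The metric on $X=\mathbb R^n$ is $d(x,y)=\|x-y\|$, and $\bar B(p,t)$ denotes the closed ball with center $p$ and radius $t\ge0$. A set $A\subseteq X$ is locally finite if $\bar B(p,t)\cap A$ is finite for all $p\in X$, $t\ge0$. The minimized expansion constant of a finite set $R\subseteq X$ is $$c_m(R)=\lim_{\xi\to 0^+}\ \inf_{R\subseteq A\subseteq X}\ \sup_{p\in A,\,t>\xi}\frac{|\bar B(p,2t)\cap A|}{|\bar B(p,t)\cap A|},$$ where $A$ runs over locally finite sets containing $R$. *)

theory Defs
  imports "HOL-Analysis.Analysis"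
begin

(* The type class norm fixes one norm per type (the Euclidean one on real ^ 'n), so an
   arbitrary norm on R^n is a separate function N. *)
definition is_norm :: "('a::real_vector \<Rightarrow> real) \<Rightarrow> bool" where
  "is_norm N \<longleftrightarrow>
     (\<forall>x. 0 \<le> N x) \<and>
     (\<forall>x. N x = 0 \<longleftrightarrow> x = 0) \<and>
     (\<forall>c x. N (c *\<^sub>R x) = \<bar>c\<bar> * N x) \<and>
     (\<forall>x y. N (x + y) \<le> N x + N y)"

definition norm_dist :: "('a::real_vector \<Rightarrow> real) \<Rightarrow> 'a \<Rightarrow> 'a \<Rightarrow> real" where
  "norm_dist N x y = N (x - y)"

lemma Metric_space_norm_dist:
  assumes "is_norm N"
  shows "Metric_space UNIV (norm_dist N)"
proof
  fix x y z :: 'a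
  show "0 \<le> norm_dist N x y"
    using assms by (simp add: is_norm_def norm_dist_def)
  have "N (y - x) = N ((-1) *\<^sub>R (x - y))" by simp
  also have "\<dots> = N (x - y)"
    using assms unfolding is_norm_def by (simp del: scaleR_minus_left scaleR_minus1_left)
  finally show "norm_dist N x y = norm_dist N y x"
    by (simp add: norm_dist_def)
  show "norm_dist N x y = 0 \<longleftrightarrow> x = y"
    using assms by (simp add: is_norm_def norm_dist_def)
  have "N ((x - y) + (y - z)) \<le> N (x - y) + N (y - z)"
    using assms unfolding is_norm_def by blast
  then show "norm_dist N x z \<le> norm_dist N x y + norm_dist N y z"
    by (simp add: norm_dist_def)
qed

context Metric_space
begin

definition locally_finite_set :: "'a set \<Rightarrow> bool" where
  "locally_finite_set A \<longleftrightarrow> A \<subseteq> M \<and> (\<forall>p\<in>M. \<forall>t\<ge>0. finite (mcball p t \<inter> A))"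

(* The supremum over p and t may be infinite, hence values in [0, infinity].
   Used for \<xi> > 0 and locally finite A only: then all cardinalities are those of finite
   sets, and the denominator is positive because p lies in its own ball. *)
definition expansion_above :: "real \<Rightarrow> 'a set \<Rightarrow> ennreal" where
  "expansion_above \<xi> A =
     (SUP p\<in>A. SUP t\<in>{\<xi><..}.
        ennreal (real (card (mcball p (2 * t) \<inter> A)) / real (card (mcball p t \<inter> A))))"

definition min_expansion_above :: "real \<Rightarrow> 'a set \<Rightarrow> ennreal" where
  "min_expansion_above \<xi> R =
     (INF A\<in>{A. locally_finite_set A \<and> R \<subseteq> A}. expansion_above \<xi> A)"

definition minimized_expansion_constant :: "'a set \<Rightarrow> ennreal" where
  "minimized_expansion_constant R = Lim (at_right 0) (\<lambda>\<xi>. min_expansion_above \<xi> R)"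

lemma min_expansion_above_antimono:
  assumes "\<xi> \<le> \<eta>"
  shows "min_expansion_above \<eta> R \<le> min_expansion_above \<xi> R"
proof -
  have "expansion_above \<eta> A \<le> expansion_above \<xi> A" for A
    unfolding expansion_above_def
  proof (rule SUP_mono')
    fix p
    show "(SUP t\<in>{\<eta><..}. ennreal (real (card (mcball p (2 * t) \<inter> A)) / real (card (mcball p t \<inter> A))))
        \<le> (SUP t\<in>{\<xi><..}. ennreal (real (card (mcball p (2 * t) \<inter> A)) / real (card (mcball p t \<inter> A))))"
      by (rule SUP_subset_mono) (use assms in auto)
  qed
  then show ?thesis
    unfolding min_expansion_above_def by (rule INF_mono')
qed

(* The limit exists, so Lim is never an unspecified value here. *)
lemma minimized_expansion_constant_tendsto:
  "((\<lambda>\<xi>. min_expansion_above \<xi> R) \<longlongrightarrow> minimized_expansion_constant R) (at_right 0)"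
proof -
  let ?f = "\<lambda>\<xi>. min_expansion_above \<xi> R"
  let ?L = "SUP \<xi>\<in>{0<..}. ?f \<xi>"
  have lim: "(?f \<longlongrightarrow> ?L) (at_right 0)"
  proof (rule order_tendstoI)
    fix a assume "a < ?L"
    then obtain \<eta> where \<eta>: "\<eta> > 0" "a < ?f \<eta>"
      by (auto simp: less_SUP_iff)
    show "eventually (\<lambda>\<xi>. a < ?f \<xi>) (at_right 0)"
    proof (rule eventually_at_rightI)
      fix \<xi> assume "\<xi> \<in> {0<..<\<eta>}"
      then have "?f \<eta> \<le> ?f \<xi>"
        by (intro min_expansion_above_antimono) simp
      with \<eta>(2) show "a < ?f \<xi>" by (rule less_le_trans)
    qed (fact \<eta>(1))
  next
    fix a assume a: "?L < a"
    show "eventually (\<lambda>\<xi>. ?f \<xi> < a) (at_right 0)"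
    proof (rule eventually_at_rightI)
      fix \<xi> :: real assume "\<xi> \<in> {0<..<1}"
      then have "?f \<xi> \<le> ?L"
        by (intro SUP_upper) simp
      then show "?f \<xi> < a" using a by (rule le_less_trans)
    qed simp
  qed
  with tendsto_Lim[OF trivial_limit_at_right_real lim] show ?thesis
    unfolding minimized_expansion_constant_def by simp
qed

end

end

theory Submission
  imports Defs
begin

text \<open>
  For \<open>\<xi> > 0\<close> enlarge \<open>R\<close> by a cubic lattice of mesh \<open>\<delta>\<close>. Comparing lattice points with the
  cubes attached to them, the number of lattice points in a ball of radius \<open>r\<close> times \<open>\<delta>\<^sup>n\<close> lies
  between the volumes of the concentric balls of radii \<open>r - c \<delta>\<close> and \<open>r + c \<delta>\<close>. Hence for radii
  above \<open>\<xi>\<close> the expansion ratios of the enlarged set are uniformly close to \<open>2\<^sup>n\<close> as \<open>\<delta>\<close> tends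
  to \<open>0\<close>, the contribution of the finite set \<open>R\<close> being of order \<open>\<delta>\<^sup>n\<close>.
\<close>

section \<open>Elementary properties of an arbitrary norm and its closed balls\<close>

definition norm_ball :: "('a::real_vector \<Rightarrow> real) \<Rightarrow> 'a \<Rightarrow> real \<Rightarrow> 'a set" where
  "norm_ball N p r = {x. N (p - x) \<le> r}"

text \<open>Bridge from the closed balls of the abstract metric to plain sets of vectors, to which
  Lebesgue measure applies.\<close>

lemma mcball_norm_dist:
  assumes "is_norm N"
  shows "Metric_space.mcball UNIV (norm_dist N) p r = norm_ball N p r"
proof -
  interpret Metric_space UNIV "norm_dist N" by (rule Metric_space_norm_dist[OF assms])
  show ?thesis by (auto simp: norm_ball_def norm_dist_def)
qed

lemma is_norm_minus:
  assumes "is_norm N" shows "N (- x) = N x"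
proof -
  have "N ((-1) *\<^sub>R x) = N x"
    using assms unfolding is_norm_def by (simp del: scaleR_minus_left scaleR_minus1_left)
  then show ?thesis by simp
qed

lemma is_norm_minus_commute:
  assumes "is_norm N" shows "N (x - y) = N (y - x)"
  using is_norm_minus[OF assms, of "x - y"] by simp

lemma is_norm_triangle:
  assumes "is_norm N" shows "N (x - z) \<le> N (x - y) + N (y - z)"
proof -
  have "N ((x - y) + (y - z)) \<le> N (x - y) + N (y - z)"
    using assms unfolding is_norm_def by blast
  then show ?thesis by simp
qed

section \<open>Comparison with the Euclidean norm\<close>

text \<open>Triangle inequality and homogeneity along the expansion of \<open>x\<close> in the
  standard basis. The coordinatewise form gives both the comparison with \<open>norm\<close> and the
  bound for \<open>N\<close> on small cubes.\<close>

lemma is_norm_le_sum_Basis: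
  fixes N :: "'a::euclidean_space \<Rightarrow> real"
  assumes N: "is_norm N"
  shows "N x \<le> (\<Sum>b\<in>Basis. \<bar>x \<bullet> b\<bar> * N b)"
proof -
  have "N (\<Sum>b\<in>B. (x \<bullet> b) *\<^sub>R b) \<le> (\<Sum>b\<in>B. \<bar>x \<bullet> b\<bar> * N b)" if "finite B" for B
    using that
  proof (induction B rule: finite_induct)
    case empty
    have "N 0 = 0" using N unfolding is_norm_def by blast
    then show ?case by simp
  next
    case (insert b B)
    have "N ((x \<bullet> b) *\<^sub>R b + (\<Sum>b\<in>B. (x \<bullet> b) *\<^sub>R b)) \<le> N ((x \<bullet> b) *\<^sub>R b) + N (\<Sum>b\<in>B. (x \<bullet> b) *\<^sub>R b)"
      using N unfolding is_norm_def by blast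
    moreover have "N ((x \<bullet> b) *\<^sub>R b) = \<bar>x \<bullet> b\<bar> * N b"
      using N unfolding is_norm_def by blast
    ultimately show ?case using insert by simp
  qed
  from this[OF finite_Basis] show ?thesis by (simp add: euclidean_representation)
qed

lemma is_norm_le_norm:
  fixes N :: "'a::euclidean_space \<Rightarrow> real"
  assumes N: "is_norm N"
  shows "N x \<le> (\<Sum>b\<in>Basis. N b) * norm x"
proof -
  have "N x \<le> (\<Sum>b\<in>Basis. \<bar>x \<bullet> b\<bar> * N b)" by (rule is_norm_le_sum_Basis[OF N])
  also have "\<dots> \<le> (\<Sum>b\<in>Basis. norm x * N b)"
    using N by (intro sum_mono mult_right_mono) (auto simp: Basis_le_norm is_norm_def)
  finally show ?thesis by (simp add: sum_distrib_left mult.commute)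
qed

text \<open>Serves twice: it yields the continuity of \<open>N\<close>, and the convexity of its
  balls, hence their measurability.\<close>

lemma convex_on_is_norm:
  assumes N: "is_norm N" shows "convex_on UNIV N"
proof (rule convex_onI)
  fix t :: real and x y assume "0 < t" "t < 1"
  have "N ((1 - t) *\<^sub>R x + t *\<^sub>R y) \<le> N ((1 - t) *\<^sub>R x) + N (t *\<^sub>R y)"
    using N unfolding is_norm_def by blast
  also have "\<dots> = \<bar>1 - t\<bar> * N x + \<bar>t\<bar> * N y"
    using N unfolding is_norm_def by metis
  finally show "N ((1 - t) *\<^sub>R x + t *\<^sub>R y) \<le> (1 - t) * N x + t * N y"
    using \<open>0 < t\<close> \<open>t < 1\<close> by simp
qed simp

text \<open>By compactness \<open>N\<close> attains a minimum on the Euclidean unit sphere. It is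
  positive, and homogeneity carries the bound over to all vectors.\<close>

lemma is_norm_ge_norm:
  fixes N :: "'a::euclidean_space \<Rightarrow> real"
  assumes N: "is_norm N"
  obtains m where "m > 0" "\<And>x. m * norm x \<le> N x"
proof -
  have "continuous_on (sphere 0 1) N"
    using convex_on_continuous[OF open_UNIV convex_on_is_norm[OF N]] continuous_on_subset by blast
  moreover have "sphere (0::'a) 1 \<noteq> {}" by simp
  ultimately obtain u where u: "norm u = 1" and le: "\<And>x. norm x = 1 \<Longrightarrow> N u \<le> N x"
    using continuous_attains_inf[OF compact_sphere, of 0 1 N] by auto
  have "u \<noteq> 0" using u by auto
  then have "N u > 0" using N unfolding is_norm_def by (metis order_le_less)
  moreover have "N u * norm x \<le> N x" for x
  proof (cases "x = 0")
    case True
    then show ?thesis using N by (simp add: is_norm_def)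
  next
    case False
    have "N u \<le> N (inverse (norm x) *\<^sub>R x)" using False by (intro le) simp
    also have "\<dots> = \<bar>inverse (norm x)\<bar> * N x"
      using N unfolding is_norm_def by blast
    finally show ?thesis using False by (simp add: field_simps)
  qed
  ultimately show ?thesis by (rule that)
qed

section \<open>Volumes of norm balls\<close>

lemma norm_ball_eq_affine_image:
  assumes N: "is_norm N" and "r > 0"
  shows "norm_ball N p r = (\<lambda>x. r *\<^sub>R x + p) ` norm_ball N 0 1"
proof (intro set_eqI iffI)
  fix x assume x: "x \<in> norm_ball N p r"
  let ?y = "inverse r *\<^sub>R (x - p)"
  have "N (- ?y) = \<bar>inverse r\<bar> * N (x - p)"
    using N is_norm_minus[OF N] unfolding is_norm_def by metis
  also have "\<dots> \<le> 1"
    using x \<open>r > 0\<close> is_norm_minus_commute[OF N, of x p] by (simp add: norm_ball_def field_simps)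
  finally have "?y \<in> norm_ball N 0 1" by (simp add: norm_ball_def)
  moreover have "x = r *\<^sub>R ?y + p" using \<open>r > 0\<close> by simp
  ultimately show "x \<in> (\<lambda>x. r *\<^sub>R x + p) ` norm_ball N 0 1" by blast
next
  fix x assume "x \<in> (\<lambda>x. r *\<^sub>R x + p) ` norm_ball N 0 1"
  then obtain y where y: "N (- y) \<le> 1" and x: "x = r *\<^sub>R y + p" by (auto simp: norm_ball_def)
  have "N (p - x) = N (r *\<^sub>R (- y))" by (simp add: x)
  also have "\<dots> = \<bar>r\<bar> * N (- y)" using N unfolding is_norm_def by blast
  also have "\<dots> \<le> r" using y \<open>r > 0\<close> by simp
  finally show "x \<in> norm_ball N p r" by (simp add: norm_ball_def)
qed

text \<open>Bounded convex sets are Lebesgue measurable with finite measure; boundedness comes from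
  \<open>is_norm_ge_norm\<close>.\<close>

lemma lmeasurable_norm_ball:
  fixes N :: "'a::euclidean_space \<Rightarrow> real"
  assumes N: "is_norm N"
  shows "norm_ball N p r \<in> lmeasurable"
proof (rule measurable_convex)
  show "convex (norm_ball N p r)"
  proof (rule convexI)
    fix x y :: 'a and u v :: real
    assume xy: "x \<in> norm_ball N p r" "y \<in> norm_ball N p r" and uv: "0 \<le> u" "0 \<le> v" "u + v = 1"
    have "p - (u *\<^sub>R x + v *\<^sub>R y) = u *\<^sub>R (p - x) + v *\<^sub>R (p - y)"
      using uv by (simp add: algebra_simps flip: scaleR_add_left)
    then have "N (p - (u *\<^sub>R x + v *\<^sub>R y)) \<le> u * N (p - x) + v * N (p - y)"
      using convex_on_is_norm[OF N] uv unfolding convex_on_def by simp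
    also have "\<dots> \<le> r"
      using xy uv by (intro convex_bound_le) (auto simp: norm_ball_def)
    finally show "u *\<^sub>R x + v *\<^sub>R y \<in> norm_ball N p r" by (simp add: norm_ball_def)
  qed
  obtain m where m: "m > 0" "\<And>x. m * norm x \<le> N x" using is_norm_ge_norm[OF N] by blast
  have "norm_ball N p r \<subseteq> cball p (r / m)"
  proof
    fix x assume "x \<in> norm_ball N p r"
    then have "m * norm (p - x) \<le> r" using m(2)[of "p - x"] by (simp add: norm_ball_def)
    then show "x \<in> cball p (r / m)" using m(1) by (simp add: dist_norm field_simps)
  qed
  then show "bounded (norm_ball N p r)" using bounded_subset bounded_cball by blast
qed

text \<open>A ball is an affine image of the unit ball. This scaling exponent is the source of the
  final \<open>2 ^ DIM('a)\<close>.\<close>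

lemma measure_norm_ball:
  fixes N :: "'a::euclidean_space \<Rightarrow> real"
  assumes "is_norm N" "r > 0"
  shows "measure lebesgue (norm_ball N p r) = r ^ DIM('a) * measure lebesgue (norm_ball N 0 1)"
  using \<open>r > 0\<close> by (simp add: norm_ball_eq_affine_image[OF assms] measure_lebesgue_affine)

lemma measure_unit_norm_ball_pos:
  fixes N :: "'a::euclidean_space \<Rightarrow> real"
  assumes N: "is_norm N"
  shows "measure lebesgue (norm_ball N 0 1) > 0"
proof -
  \<comment> \<open>The summand 1 makes \<open>C\<close> positive at once, so that the Euclidean
    ball of radius \<open>1 / C\<close> can be placed inside the unit ball of
    \<open>N\<close>.\<close>
  define C where "C = 1 + (\<Sum>b\<in>Basis. N b)"
  have "C > 0" using N by (auto simp: C_def is_norm_def intro!: add_pos_nonneg sum_nonneg)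
  have "ball 0 (1 / C) \<subseteq> norm_ball N 0 1"
  proof
    fix x :: 'a assume "x \<in> ball 0 (1 / C)"
    then have "C * norm x \<le> 1" using \<open>C > 0\<close> by (simp add: field_simps)
    moreover have "N x \<le> C * norm x"
      using is_norm_le_norm[OF N, of x] by (simp add: C_def algebra_simps add_increasing)
    ultimately show "x \<in> norm_ball N 0 1" by (simp add: norm_ball_def is_norm_minus[OF N])
  qed
  then have "measure lebesgue (ball (0::'a) (1 / C)) \<le> measure lebesgue (norm_ball N 0 1)"
    by (intro measure_mono_fmeasurable lmeasurable_norm_ball[OF N]) auto
  moreover have "measure lebesgue (ball (0::'a) (1 / C)) > 0"
    using \<open>C > 0\<close> content_ball_pos[of "1 / C" "0::'a"] by (simp add: measure_completion)
  ultimately show ?thesis by linarith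
qed

section \<open>The cubic lattice and its tiling by half-open cubes\<close>

definition cubic_lattice :: "real \<Rightarrow> 'a::euclidean_space set" where
  "cubic_lattice \<delta> = {x. \<forall>b\<in>Basis. x \<bullet> b / \<delta> \<in> \<int>}"

text \<open>Half-open, so that for \<delta> > 0 the translates by lattice points tile the space:
  every point lies in exactly one of them.\<close>

definition half_open_cube :: "real \<Rightarrow> 'a::euclidean_space set" where
  "half_open_cube \<delta> = {x. \<forall>b\<in>Basis. 0 \<le> x \<bullet> b \<and> x \<bullet> b < \<delta>}"

lemma half_open_cube_subset_cbox: "half_open_cube \<delta> \<subseteq> cbox 0 (\<delta> *\<^sub>R One)"
  by (auto simp: half_open_cube_def mem_box less_imp_le)

lemma lmeasurable_half_open_cube: "half_open_cube \<delta> \<in> lmeasurable"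
proof (rule measurable_convex)
  show "convex (half_open_cube \<delta> :: 'a set)"
    unfolding half_open_cube_def convex_def
    by (auto simp: inner_add_left intro: convex_bound_lt)
  show "bounded (half_open_cube \<delta> :: 'a set)"
    using half_open_cube_subset_cbox bounded_cbox bounded_subset by blast
qed

text \<open>The cube is squeezed between an open and a closed box of the same volume.\<close>

lemma measure_half_open_cube:
  assumes "\<delta> > 0"
  shows "measure lebesgue (half_open_cube \<delta> :: 'a::euclidean_space set) = \<delta> ^ DIM('a)"
proof (rule antisym)
  have "measure lebesgue (half_open_cube \<delta> :: 'a set) \<le> measure lebesgue (cbox (0::'a) (\<delta> *\<^sub>R One))"
    by (intro measure_mono_fmeasurable half_open_cube_subset_cbox)
       (auto intro: lmeasurable_half_open_cube fmeasurableD)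
  then show "measure lebesgue (half_open_cube \<delta> :: 'a set) \<le> \<delta> ^ DIM('a)"
    using assms by (simp add: content_cbox_if measure_completion box_eq_empty split: if_splits)
  have "box 0 (\<delta> *\<^sub>R One) \<subseteq> (half_open_cube \<delta> :: 'a set)"
    by (auto simp: half_open_cube_def mem_box less_imp_le)
  then have "measure lebesgue (box (0::'a) (\<delta> *\<^sub>R One)) \<le> measure lebesgue (half_open_cube \<delta> :: 'a set)"
    by (intro measure_mono_fmeasurable lmeasurable_half_open_cube) auto
  then show "\<delta> ^ DIM('a) \<le> measure lebesgue (half_open_cube \<delta> :: 'a set)"
    using assms by (simp add: measure_lborel_box_eq measure_completion)
qed

lemma cubic_lattice_cover:
  assumes "\<delta> > 0"
  obtains z where "z \<in> cubic_lattice \<delta>" "x - z \<in> half_open_cube \<delta>"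
proof
  \<comment> \<open>Each coordinate of \<open>x\<close> is rounded down to a multiple of
    \<delta>.\<close>
  define z where "z = (\<Sum>b\<in>Basis. (\<delta> * of_int \<lfloor>x \<bullet> b / \<delta>\<rfloor>) *\<^sub>R b)"
  have z: "z \<bullet> b = \<delta> * of_int \<lfloor>x \<bullet> b / \<delta>\<rfloor>" if "b \<in> Basis" for b
    using that by (simp add: z_def)
  show "z \<in> cubic_lattice \<delta>" using assms by (simp add: cubic_lattice_def z)
  have "\<delta> * of_int \<lfloor>y / \<delta>\<rfloor> \<le> y" "y - \<delta> * of_int \<lfloor>y / \<delta>\<rfloor> < \<delta>" for y :: real
    using floor_divide_lower[OF assms, of y] floor_divide_upper[OF assms, of y]
    by (simp_all add: algebra_simps)
  then show "x - z \<in> half_open_cube \<delta>"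
    by (simp add: half_open_cube_def inner_diff_left z)
qed

text \<open>Corresponding coordinates of \<open>z\<close> and \<open>w\<close> are integer multiples
  of \<delta> that differ by less than \<delta>, hence agree.\<close>

lemma cubic_lattice_cubes_disjoint:
  assumes "\<delta> > 0" "z \<in> cubic_lattice \<delta>" "w \<in> cubic_lattice \<delta>"
    and "x - z \<in> half_open_cube \<delta>" "x - w \<in> half_open_cube \<delta>"
  shows "z = w"
proof (rule euclidean_eqI)
  fix b :: 'a assume b: "b \<in> Basis"
  have "\<bar>z \<bullet> b - w \<bullet> b\<bar> < \<delta>"
    using assms(4,5) b by (force simp: half_open_cube_def inner_diff_left abs_less_iff)
  then have "\<bar>z \<bullet> b / \<delta> - w \<bullet> b / \<delta>\<bar> < 1"
    using \<open>\<delta> > 0\<close> by (simp flip: diff_divide_distrib)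
  moreover obtain i j where ij: "z \<bullet> b / \<delta> = of_int i" "w \<bullet> b / \<delta> = of_int j"
    using assms(2,3) b by (metis (mono_tags, lifting) Ints_cases cubic_lattice_def mem_Collect_eq)
  ultimately have "\<bar>of_int (i - j) :: real\<bar> < 1" by simp
  then have "i = j" by linarith
  with ij have "z \<bullet> b / \<delta> = w \<bullet> b / \<delta>" by simp
  then show "z \<bullet> b = w \<bullet> b" using \<open>\<delta> > 0\<close> by simp
qed

text \<open>The factor of \<delta> is the constant \<open>c\<close> of the volume estimates: passing
  between a lattice point and a point of its cube changes \<open>N\<close>-distances by at most
  \<open>c * \<delta>\<close>.\<close>

lemma is_norm_half_open_cube_le:
  assumes N: "is_norm N" and x: "x \<in> half_open_cube \<delta>"
  shows "N x \<le> (\<Sum>b\<in>Basis. N b) * \<delta>"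
proof -
  have "N x \<le> (\<Sum>b\<in>Basis. \<bar>x \<bullet> b\<bar> * N b)" by (rule is_norm_le_sum_Basis[OF N])
  also have "\<dots> \<le> (\<Sum>b\<in>Basis. \<delta> * N b)"
    using x N by (intro sum_mono mult_right_mono) (auto simp: half_open_cube_def is_norm_def less_imp_le)
  finally show ?thesis by (simp add: sum_distrib_left mult.commute)
qed

section \<open>Counting lattice points in balls by volume\<close>

lemma measure_cubes:
  fixes F :: "'a::euclidean_space set" and \<delta> :: real
  assumes "\<delta> > 0" "F \<subseteq> cubic_lattice \<delta>" "finite F"
  shows "measure lebesgue (\<Union>z\<in>F. (+) z ` half_open_cube \<delta>) = card F * \<delta> ^ DIM('a)"
proof -
  have "pairwise (\<lambda>z w. disjnt ((+) z ` half_open_cube \<delta>) ((+) w ` half_open_cube \<delta>)) F"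
  proof (rule pairwiseI)
    fix z w assume zw: "z \<in> F" "w \<in> F" "z \<noteq> w"
    show "disjnt ((+) z ` half_open_cube \<delta>) ((+) w ` half_open_cube \<delta>)"
    proof (rule ccontr)
      assume "\<not> ?thesis"
      then obtain x u v where "x = z + u" "x = w + v" and uv: "u \<in> half_open_cube \<delta>" "v \<in> half_open_cube \<delta>"
        unfolding disjnt_iff by blast
      then have "x - z = u" "x - w = v" by (metis add_diff_cancel_left')+
      with uv have "x - z \<in> half_open_cube \<delta>" "x - w \<in> half_open_cube \<delta>" by simp_all
      then show False using cubic_lattice_cubes_disjoint[of \<delta> z w x] assms zw by blast
    qed
  qed
  then have "measure lebesgue (\<Union>z\<in>F. (+) z ` half_open_cube \<delta>)
      = (\<Sum>z\<in>F. measure lebesgue ((+) z ` (half_open_cube \<delta> :: 'a set)))"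
    using assms by (intro measure_UNION' measurable_translation lmeasurable_half_open_cube) auto
  then show ?thesis using assms by (simp add: measure_translation measure_half_open_cube)
qed

text \<open>The disjoint cubes attached to the lattice points of the ball all lie in the concentric
  ball of radius \<open>r + c * \<delta>\<close>.\<close>

lemma lattice_points_norm_ball_upper:
  fixes N :: "'a::euclidean_space \<Rightarrow> real" and p :: 'a and \<delta> r c V :: real
  assumes N: "is_norm N" and \<delta>: "\<delta> > 0" and r: "r > 0"
  defines "c \<equiv> \<Sum>b\<in>Basis. N b" and "V \<equiv> measure lebesgue (norm_ball N 0 1)"
  shows "finite (norm_ball N p r \<inter> cubic_lattice \<delta>)"
    and "card (norm_ball N p r \<inter> cubic_lattice \<delta>) * \<delta> ^ DIM('a) \<le> V * (r + c * \<delta>) ^ DIM('a)"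
proof -
  let ?S = "norm_ball N p r \<inter> cubic_lattice \<delta>"
  have "c \<ge> 0" using N by (auto simp: c_def is_norm_def intro!: sum_nonneg)
  with r \<delta> have pos: "r + c * \<delta> > 0" by (simp add: add_pos_nonneg)
  \<comment> \<open>Stated for finite subsets \<open>F\<close>, since the finiteness of
    \<open>?S\<close> is not yet known; the uniform bound on \<open>card F\<close> then yields
    it.\<close>
  have bound: "card F * \<delta> ^ DIM('a) \<le> V * (r + c * \<delta>) ^ DIM('a)" if F: "F \<subseteq> ?S" "finite F" for F
  proof -
    have "(\<Union>z\<in>F. (+) z ` half_open_cube \<delta>) \<subseteq> norm_ball N p (r + c * \<delta>)"
    proof clarify
      fix z q assume z: "z \<in> F" and q: "q \<in> (half_open_cube \<delta> :: 'a set)"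
      have "N (p - (z + q)) \<le> N (p - z) + N (z - (z + q))" by (rule is_norm_triangle[OF N])
      also have "N (z - (z + q)) = N q" using is_norm_minus[OF N, of q] by simp
      also have "N (p - z) + N q \<le> r + c * \<delta>"
        using z F is_norm_half_open_cube_le[OF N q]
        by (intro add_mono) (auto simp: norm_ball_def c_def)
      finally show "z + q \<in> norm_ball N p (r + c * \<delta>)" by (simp add: norm_ball_def)
    qed
    then have "measure lebesgue (\<Union>z\<in>F. (+) z ` half_open_cube \<delta>)
        \<le> measure lebesgue (norm_ball N p (r + c * \<delta>))"
      using F by (intro measure_mono_fmeasurable lmeasurable_norm_ball[OF N] sets.finite_UN
          fmeasurableD measurable_translation lmeasurable_half_open_cube) auto
    then show ?thesis
      using F \<delta> measure_norm_ball[OF N pos, of p] by (simp add: measure_cubes V_def mult.commute)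
  qed
  let ?K = "V * (r + c * \<delta>) ^ DIM('a) / \<delta> ^ DIM('a)"
  have "card F \<le> nat \<lfloor>?K\<rfloor>" if "F \<subseteq> ?S" "finite F" for F
    using bound[OF that] \<delta> by (simp add: le_nat_floor field_simps)
  then show fin: "finite ?S" using finite_if_finite_subsets_card_bdd by blast
  show "card ?S * \<delta> ^ DIM('a) \<le> V * (r + c * \<delta>) ^ DIM('a)"
    using bound fin by blast
qed

text \<open>The cubes attached to the lattice points of the ball cover the concentric ball of radius
  \<open>r - c * \<delta>\<close>, because every point is within \<open>c * \<delta>\<close> of the
  corner of its cube. The assumption on \<open>r\<close> keeps this smaller radius positive, as the
  scaling of volumes requires.\<close>

lemma lattice_points_norm_ball_lower:
  fixes N :: "'a::euclidean_space \<Rightarrow> real" and p :: 'a and \<delta> r c V :: real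
  assumes N: "is_norm N" and \<delta>: "\<delta> > 0" and r: "r > (\<Sum>b\<in>Basis. N b) * \<delta>"
  defines "c \<equiv> \<Sum>b\<in>Basis. N b" and "V \<equiv> measure lebesgue (norm_ball N 0 1)"
  shows "V * (r - c * \<delta>) ^ DIM('a) \<le> card (norm_ball N p r \<inter> cubic_lattice \<delta>) * \<delta> ^ DIM('a)"
proof -
  let ?S = "norm_ball N p r \<inter> cubic_lattice \<delta>"
  have "c \<ge> 0" using N by (auto simp: c_def is_norm_def intro!: sum_nonneg)
  then have "c * \<delta> \<ge> 0" using \<delta> by simp
  then have "r > 0" using r by (simp add: c_def)
  then have fin: "finite ?S" by (rule lattice_points_norm_ball_upper(1)[OF N \<delta>])
  have "norm_ball N p (r - c * \<delta>) \<subseteq> (\<Union>z\<in>?S. (+) z ` half_open_cube \<delta>)"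
  proof
    fix x assume x: "x \<in> norm_ball N p (r - c * \<delta>)"
    obtain z where z: "z \<in> cubic_lattice \<delta>" "x - z \<in> half_open_cube \<delta>"
      using cubic_lattice_cover[OF \<delta>] by blast
    have "N (p - z) \<le> N (p - x) + N (x - z)" by (rule is_norm_triangle[OF N])
    also have "\<dots> \<le> (r - c * \<delta>) + c * \<delta>"
      using x is_norm_half_open_cube_le[OF N z(2)]
      by (intro add_mono) (auto simp: norm_ball_def c_def)
    finally have "z \<in> ?S" using z by (simp add: norm_ball_def)
    moreover have "x = z + (x - z)" by simp
    ultimately show "x \<in> (\<Union>z\<in>?S. (+) z ` half_open_cube \<delta>)" using z(2) by blast
  qed
  moreover have "(\<Union>z\<in>?S. (+) z ` (half_open_cube \<delta> :: 'a set)) \<in> lmeasurable"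
    by (rule fmeasurable.finite_UN[OF fin measurable_translation[OF lmeasurable_half_open_cube]])
  ultimately have "measure lebesgue (norm_ball N p (r - c * \<delta>))
      \<le> measure lebesgue (\<Union>z\<in>?S. (+) z ` half_open_cube \<delta>)"
    using lmeasurable_norm_ball[OF N] by (intro measure_mono_fmeasurable) (auto dest: fmeasurableD)
  then show ?thesis
    using fin \<delta> r measure_norm_ball[OF N, of "r - c * \<delta>" p]
    by (simp add: measure_cubes V_def c_def mult.commute)
qed

section \<open>Expansion ratios of the enlarged set and passage to the limit\<close>

text \<open>The bound is free of \<open>p\<close> and \<open>t\<close>, so it also bounds the
  supremum in \<open>expansion_above\<close>. It comes from the two lattice counts at radii
  \<open>2 * t\<close> and \<open>t\<close>, followed by monotonicity in \<open>t\<close>.\<close>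

lemma expansion_ratio_le:
  fixes N :: "'a::euclidean_space \<Rightarrow> real" and p :: 'a and \<delta> \<xi> t c V :: real
  assumes N: "is_norm N" and R: "finite R" and \<delta>: "\<delta> > 0"
    and \<xi>: "\<xi> > (\<Sum>b\<in>Basis. N b) * \<delta>" and t: "t > \<xi>"
  defines "c \<equiv> \<Sum>b\<in>Basis. N b" and "V \<equiv> measure lebesgue (norm_ball N 0 1)"
    and "A \<equiv> R \<union> cubic_lattice \<delta>"
  shows "real (card (norm_ball N p (2 * t) \<inter> A)) / real (card (norm_ball N p t \<inter> A))
    \<le> card R * \<delta> ^ DIM('a) / (V * (\<xi> - c * \<delta>) ^ DIM('a))
      + ((2 * \<xi> + c * \<delta>) / (\<xi> - c * \<delta>)) ^ DIM('a)" (is "?a / ?b \<le> _")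
proof -
  let ?n = "DIM('a)"
  let ?L = "cubic_lattice \<delta> :: 'a set"
  have "c \<ge> 0" using N by (auto simp: c_def is_norm_def intro!: sum_nonneg)
  then have c\<delta>: "c * \<delta> \<ge> 0" using \<delta> by simp
  have \<xi>': "\<xi> - c * \<delta> > 0" "t - c * \<delta> > 0" "t > 0" using \<xi> t c\<delta> by (auto simp: c_def)
  have V: "V > 0" unfolding V_def by (rule measure_unit_norm_ball_pos[OF N])
  have finL: "finite (norm_ball N p r \<inter> ?L)" if "r > 0" for r
    using lattice_points_norm_ball_upper(1)[OF N \<delta> that] .
  \<comment> \<open>In the numerator \<open>R\<close> adds at most \<open>card R\<close> points; in
    the denominator it is simply dropped.\<close>
  have "card (norm_ball N p (2 * t) \<inter> A) \<le> card (R \<union> (norm_ball N p (2 * t) \<inter> ?L))"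
    using finL[of "2 * t"] \<xi>' R by (intro card_mono) (auto simp: A_def)
  also have "\<dots> \<le> card R + card (norm_ball N p (2 * t) \<inter> ?L)" by (rule card_Un_le)
  finally have "?a * \<delta> ^ ?n \<le> (card R + card (norm_ball N p (2 * t) \<inter> ?L)) * \<delta> ^ ?n"
    using \<delta> by (simp del: of_nat_add add: mult_right_mono)
  then have a: "?a * \<delta> ^ ?n \<le> card R * \<delta> ^ ?n + V * (2 * t + c * \<delta>) ^ ?n"
    using lattice_points_norm_ball_upper(2)[OF N \<delta>, of "2 * t" p] \<xi>'
    by (simp add: V_def c_def algebra_simps)
  have "card (norm_ball N p t \<inter> ?L) \<le> card (norm_ball N p t \<inter> A)"
    using finL[of t] \<xi>' R by (intro card_mono) (auto simp: A_def Int_Un_distrib)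
  then have "card (norm_ball N p t \<inter> ?L) * \<delta> ^ ?n \<le> ?b * \<delta> ^ ?n"
    using \<delta> by (simp add: mult_right_mono)
  then have b: "V * (t - c * \<delta>) ^ ?n \<le> ?b * \<delta> ^ ?n"
    using lattice_points_norm_ball_lower[OF N \<delta>, of t p] \<xi> t by (simp add: V_def c_def)
  have Vt: "V * (t - c * \<delta>) ^ ?n > 0" using V \<xi>' by simp
  \<comment> \<open>Multiplying both counts by the volume of one cube makes the volume bounds
    applicable.\<close>
  have "?a / ?b = (?a * \<delta> ^ ?n) / (?b * \<delta> ^ ?n)" using \<delta> by simp
  also have "\<dots> \<le> (card R * \<delta> ^ ?n + V * (2 * t + c * \<delta>) ^ ?n) / (V * (t - c * \<delta>) ^ ?n)"
    using a b Vt \<delta> V \<xi>' c\<delta> by (intro frac_le) (auto intro!: add_nonneg_nonneg mult_nonneg_nonneg)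
  also have "\<dots> = card R * \<delta> ^ ?n / (V * (t - c * \<delta>) ^ ?n) + ((2 * t + c * \<delta>) / (t - c * \<delta>)) ^ ?n"
    unfolding add_divide_distrib[of "_ * _ ^ _"] power_divide using V by simp
  also have "\<dots> \<le> card R * \<delta> ^ ?n / (V * (\<xi> - c * \<delta>) ^ ?n) + ((2 * \<xi> + c * \<delta>) / (\<xi> - c * \<delta>)) ^ ?n"
  proof (intro add_mono power_mono)
    show "card R * \<delta> ^ ?n / (V * (t - c * \<delta>) ^ ?n) \<le> card R * \<delta> ^ ?n / (V * (\<xi> - c * \<delta>) ^ ?n)"
      using V \<xi>' t \<delta> by (intro divide_left_mono mult_left_mono power_mono mult_pos_pos) auto
    \<comment> \<open>After clearing the positive denominators, the comparison of the two quotients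
      reduces to three times this inequality.\<close>
    have "c * \<delta> * \<xi> \<le> c * \<delta> * t" using c\<delta> t by (intro mult_left_mono) auto
    then show "(2 * t + c * \<delta>) / (t - c * \<delta>) \<le> (2 * \<xi> + c * \<delta>) / (\<xi> - c * \<delta>)"
      using \<xi>' by (simp add: frac_le_eq divide_le_0_iff) (simp add: algebra_simps)
    show "0 \<le> (2 * t + c * \<delta>) / (t - c * \<delta>)" using \<xi>' c\<delta> by simp
  qed
  finally show ?thesis .
qed

theorem minimized_expansion_constant_le:
  fixes N :: "'a::euclidean_space \<Rightarrow> real"
  assumes N: "is_norm N" and R: "finite R"
  shows "Metric_space.minimized_expansion_constant UNIV (norm_dist N) R \<le> 2 ^ DIM('a)"
proof -
  interpret Metric_space UNIV "norm_dist N" by (rule Metric_space_norm_dist[OF N])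
  note mcball = mcball_norm_dist[OF N]
  define c where "c = (\<Sum>b\<in>Basis. N b)"
  define V where "V = measure lebesgue (norm_ball N 0 1)"
  have V: "V > 0" unfolding V_def by (rule measure_unit_norm_ball_pos[OF N])
  have "min_expansion_above \<xi> R \<le> 2 ^ DIM('a)" if \<xi>: "\<xi> > 0" for \<xi>
  proof -
    define h where "h \<delta> = card R * \<delta> ^ DIM('a) / (V * (\<xi> - c * \<delta>) ^ DIM('a))
      + ((2 * \<xi> + c * \<delta>) / (\<xi> - c * \<delta>)) ^ DIM('a)" for \<delta> :: real
    have le: "min_expansion_above \<xi> R \<le> ennreal (h \<delta>)" if \<delta>: "\<delta> > 0" "c * \<delta> < \<xi>" for \<delta>
    proof -
      let ?A = "R \<union> cubic_lattice \<delta>"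
      have "finite (mcball p t \<inter> ?A)" for p t
      proof -
        \<comment> \<open>The lattice count requires a positive radius, whereas \<open>t\<close> may
          be 0 here; hence \<open>max t 1\<close>.\<close>
        have "finite (norm_ball N p (max t 1) \<inter> ?A)"
          using lattice_points_norm_ball_upper(1)[OF N \<delta>(1)] R by (simp add: Int_Un_distrib)
        then show ?thesis
          unfolding mcball by (rule rev_finite_subset) (auto simp: norm_ball_def)
      qed
      then have "locally_finite_set ?A" by (simp add: locally_finite_set_def)
      then have "min_expansion_above \<xi> R \<le> expansion_above \<xi> ?A"
        unfolding min_expansion_above_def by (intro INF_lower) auto
      also have "\<dots> \<le> ennreal (h \<delta>)"
        unfolding expansion_above_def mcball h_def c_def V_def
        using expansion_ratio_le[OF N R \<delta>(1)] \<delta>(2)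
        by (intro SUP_least ennreal_leI) (auto simp: c_def)
      finally show ?thesis .
    qed
    have "(h \<longlongrightarrow> h 0) (at_right 0)"
      unfolding h_def using V \<xi> by (intro tendsto_intros) auto
    \<comment> \<open>At \<delta> = 0 the first summand vanishes because \<open>DIM('a)\<close> is
      positive, and the second is \<open>(2 * \<xi> / \<xi>) ^ DIM('a)\<close>.\<close>
    moreover have "h 0 = 2 ^ DIM('a)" using \<xi> by (simp add: h_def)
    ultimately have "((\<lambda>\<delta>. ennreal (h \<delta>)) \<longlongrightarrow> ennreal (2 ^ DIM('a))) (at_right 0)"
      by (metis tendsto_ennrealI)
    moreover have "eventually (\<lambda>\<delta>. min_expansion_above \<xi> R \<le> ennreal (h \<delta>)) (at_right 0)"
    proof -
      have "((\<lambda>\<delta>. c * \<delta>) \<longlongrightarrow> c * 0) (at_right 0)" by (intro tendsto_intros)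
      then have "eventually (\<lambda>\<delta>. c * \<delta> < \<xi>) (at_right 0)"
        using \<xi> by (intro order_tendstoD(2)) auto
      with eventually_at_right_less[of 0] show ?thesis
        by eventually_elim (rule le)
    qed
    \<comment> \<open>The left side does not depend on \<delta>, so the bound survives \<delta>
      tending to 0 with \<xi> fixed. Only afterwards does \<xi> tend to 0.\<close>
    ultimately have "min_expansion_above \<xi> R \<le> ennreal (2 ^ DIM('a))"
      by (intro tendsto_lowerbound) auto
    then show ?thesis by (simp add: ennreal_power[symmetric])
  qed
  then have "eventually (\<lambda>\<xi>. min_expansion_above \<xi> R \<le> 2 ^ DIM('a)) (at_right 0)"
    using eventually_at_right_less[of "0::real"] by (rule eventually_mono[rotated])
  then show ?thesis
    by (intro tendsto_upperbound[OF minimized_expansion_constant_tendsto]) auto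
qed

theorem theoremC15:
  fixes N :: "real ^ 'n \<Rightarrow> real" and R :: "(real ^ 'n) set"
  assumes "is_norm N" and "finite R"
  shows "Metric_space.minimized_expansion_constant UNIV (norm_dist N) R \<le> 2 ^ CARD('n)"
  using minimized_expansion_constant_le[OF assms] by simp

end
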